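(* Let $T=(V,E)$ be a finite tree that is not a path or a star, and let its metric $w(t)$ evolve under the Ricci flow $\frac{d}{dt}w_h=-\kappa_h w_h$, $h\in E$, from an initial metric in $\mathbb{R}_{>0}^E$. If $e$ and $g$ are two leaf edges incident to the same vertex $u$, then: (i) if $w_e(0)\le w_g(0)$, then $w_e(t)\le w_g(t)$ for all $t>0$; and if $w_e(0)>w_g(0)$, then $w_e(t)>w_g(t)$ for all $t>0$; (ii) $\lim_{t\to\infty}\big(w_e(t)-w_g(t)\big)=0$; (iii) $\frac{w_e(t)}{w_g(t)}\to 1$ as $t\to\infty$.
   Context: Trees are finite and connected; $d_u$ is the degree of $u$. Leaf edge: an edge with an endpoint of degree $1$. For a metric $w\in\mathbb{R}_{>0}^{E}$, let $d(x,y)$ be the weighted path distance and $D_x=\sum_{z\sim x}1/w_{xz}$. The curvature is the Lin-Lu-Yau version of Ollivier Ricci curvature with parameter function $\gamma(x)=1/x$: let $\mu_x^\alpha$ be the probability measure with $\mu_x^\alpha(x)=\alpha$, $\mu_x^\alpha(y)=(1-\alpha)\frac{1/w_{xy}}{D_x}$ for $y\sim x$, and $0$ otherwise; with $W$ the $L^1$ transportation distance for $d$, set $\kappa_\alpha(x,y)=1-W(\mu_x^\alpha,\mu_y^\alpha)/d(x,y)$ and $\kappa_{xy}=\lim_{\alpha\to1}\kappa_\alpha(x,y)/(1-\alpha)$. On a tree, for an edge $uv$, $\kappa_{uv}=\frac{2-d_u}{w_{uv}D_u}+\frac{2-d_v}{w_{uv}D_v}$. $\kappa_e(t)$ is the curvature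 with respect to $w(t)$. The flow has a unique positive solution for all $t\ge0$. *)

theory Defs
  imports Complex_Main
begin

(* A simple graph is a vertex set V together with a set E of two-element subsets of V;
   a weight on the edges is a function on such subsets. *)

definition simple_graph :: "'a set \<Rightarrow> 'a set set \<Rightarrow> bool" where
  "simple_graph V E \<longleftrightarrow> finite V \<and> (\<forall>e\<in>E. e \<subseteq> V \<and> card e = 2)"

definition neighbors :: "'a set set \<Rightarrow> 'a \<Rightarrow> 'a set" where
  "neighbors E x = {y. {x, y} \<in> E}"

definition degree :: "'a set set \<Rightarrow> 'a \<Rightarrow> nat" where
  "degree E x = card (neighbors E x)"

(* The one-vertex list [x] is a path from x to x. *)
definition path_between :: "'a set \<Rightarrow> 'a set set \<Rightarrow> 'a \<Rightarrow> 'a list \<Rightarrow> 'a \<Rightarrow> bool" where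
  "path_between V E x p y \<longleftrightarrow>
     p \<noteq> [] \<and> hd p = x \<and> last p = y \<and> set p \<subseteq> V \<and> distinct p \<and>
     (\<forall>i. Suc i < length p \<longrightarrow> {p ! i, p ! Suc i} \<in> E)"

definition connected_graph :: "'a set \<Rightarrow> 'a set set \<Rightarrow> bool" where
  "connected_graph V E \<longleftrightarrow> V \<noteq> {} \<and> (\<forall>x\<in>V. \<forall>y\<in>V. \<exists>p. path_between V E x p y)"

(* A cycle is a path on at least three vertices whose endpoints are adjacent. *)
definition acyclic_graph :: "'a set \<Rightarrow> 'a set set \<Rightarrow> bool" where
  "acyclic_graph V E \<longleftrightarrow>
     \<not> (\<exists>x y p. path_between V E x p y \<and> 3 \<le> length p \<and> {y, x} \<in> E)"

definition tree :: "'a set \<Rightarrow> 'a set set \<Rightarrow> bool" where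
  "tree V E \<longleftrightarrow> simple_graph V E \<and> connected_graph V E \<and> acyclic_graph V E"

definition path_graph :: "'a set \<Rightarrow> 'a set set \<Rightarrow> bool" where
  "path_graph V E \<longleftrightarrow>
     (\<exists>p. p \<noteq> [] \<and> distinct p \<and> set p = V \<and>
          E = {{p ! i, p ! Suc i} | i. Suc i < length p})"

definition star_graph :: "'a set \<Rightarrow> 'a set set \<Rightarrow> bool" where
  "star_graph V E \<longleftrightarrow> (\<exists>c\<in>V. E = {{c, v} | v. v \<in> V - {c}})"

definition leaf_edge :: "'a set set \<Rightarrow> 'a set \<Rightarrow> bool" where
  "leaf_edge E e \<longleftrightarrow> e \<in> E \<and> (\<exists>x\<in>e. degree E x = 1)"

definition path_weight :: "('a set \<Rightarrow> real) \<Rightarrow> 'a list \<Rightarrow> real" where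
  "path_weight w p = (\<Sum>i<length p - 1. w {p ! i, p ! Suc i})"

definition graph_dist :: "'a set \<Rightarrow> 'a set set \<Rightarrow> ('a set \<Rightarrow> real) \<Rightarrow> 'a \<Rightarrow> 'a \<Rightarrow> real" where
  "graph_dist V E w x y = (INF p\<in>{p. path_between V E x p y}. path_weight w p)"

definition inv_weight_sum :: "'a set set \<Rightarrow> ('a set \<Rightarrow> real) \<Rightarrow> 'a \<Rightarrow> real" where
  "inv_weight_sum E w x = (\<Sum>z\<in>neighbors E x. 1 / w {x, z})"

(* The measure mu_x^alpha, given by its values on single vertices. *)
definition walk_measure ::
    "'a set set \<Rightarrow> ('a set \<Rightarrow> real) \<Rightarrow> real \<Rightarrow> 'a \<Rightarrow> 'a \<Rightarrow> real" where
  "walk_measure E w \<alpha> x y =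
     (if y = x then \<alpha>
      else if y \<in> neighbors E x then (1 - \<alpha>) * ((1 / w {x, y}) / inv_weight_sum E w x)
      else 0)"

(* Couplings of two measures on the finite set V; values outside V \<times> V play no role. *)
definition couplings ::
    "'a set \<Rightarrow> ('a \<Rightarrow> real) \<Rightarrow> ('a \<Rightarrow> real) \<Rightarrow> ('a \<Rightarrow> 'a \<Rightarrow> real) set" where
  "couplings V \<mu> \<nu> =
     {\<pi>. (\<forall>x\<in>V. \<forall>y\<in>V. 0 \<le> \<pi> x y) \<and>
         (\<forall>x\<in>V. (\<Sum>y\<in>V. \<pi> x y) = \<mu> x) \<and>
         (\<forall>y\<in>V. (\<Sum>x\<in>V. \<pi> x y) = \<nu> y)}"

definition transport_dist ::
    "'a set \<Rightarrow> ('a \<Rightarrow> 'a \<Rightarrow> real) \<Rightarrow> ('a \<Rightarrow> real) \<Rightarrow> ('a \<Rightarrow> real) \<Rightarrow> real" where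
  "transport_dist V d \<mu> \<nu> = (INF \<pi>\<in>couplings V \<mu> \<nu>. \<Sum>x\<in>V. \<Sum>y\<in>V. \<pi> x y * d x y)"

definition curvature_alpha ::
    "'a set \<Rightarrow> 'a set set \<Rightarrow> ('a set \<Rightarrow> real) \<Rightarrow> real \<Rightarrow> 'a \<Rightarrow> 'a \<Rightarrow> real" where
  "curvature_alpha V E w \<alpha> x y =
     1 - transport_dist V (graph_dist V E w) (walk_measure E w \<alpha> x) (walk_measure E w \<alpha> y)
           / graph_dist V E w x y"

(* The limit is one-sided because the measures are probability measures only for alpha \<le> 1. *)
definition curvature ::
    "'a set \<Rightarrow> 'a set set \<Rightarrow> ('a set \<Rightarrow> real) \<Rightarrow> 'a \<Rightarrow> 'a \<Rightarrow> real" where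
  "curvature V E w x y = Lim (at_left 1) (\<lambda>\<alpha>. curvature_alpha V E w \<alpha> x y / (1 - \<alpha>))"

(* Positive solutions on [0, \<infinity>). The equation for an edge is stated for both
   orders of its endpoints; this is harmless as the curvature is symmetric. *)
definition ricci_flow ::
    "'a set \<Rightarrow> 'a set set \<Rightarrow> (real \<Rightarrow> 'a set \<Rightarrow> real) \<Rightarrow> bool" where
  "ricci_flow V E w \<longleftrightarrow>
     (\<forall>t\<ge>0. \<forall>h\<in>E. 0 < w t h) \<and>
     (\<forall>t\<ge>0. \<forall>x y. {x, y} \<in> E \<longrightarrow>
        ((\<lambda>s. w s {x, y}) has_real_derivative - curvature V E (w t) x y * w t {x, y})
          (at t within {0..}))"

end

(* On an edge uv of a tree a signed distance from u is an optimal Kantorovich potential, which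
   yields kappa_uv w_uv = (2 - d_u) / D_u + (2 - d_v) / D_v.  Hence every leaf edge h at u satisfies
   w_h' = (d_u - 2) / D_u - w_h, so w_e - w_g is a constant multiple of exp (-t).
   Every edge h at u satisfies w_h' \<ge> - w_h, so exp t * w_h is nondecreasing and
   D_u(t) \<le> exp t * D_u(0).  As d_u \<ge> 3 (otherwise the tree is a star),
   (exp t * w_g)' = (d_u - 2) exp t / D_u(t) is bounded below by a positive constant.
   So exp t * w_g tends to infinity and w_e / w_g - 1 = const / (exp t * w_g) tends to 0. *)
theory Submission
  imports Defs
begin

section \<open>Paths and distances\<close>

lemma path_between_append:
  assumes "path_between V E x p y" "path_between V E x' q y'" "{y, x'} \<in> E"
    and "set p \<inter> set q = {}"
  shows "path_between V E x (p @ q) y'"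
proof -
  have "{(p @ q) ! i, (p @ q) ! Suc i} \<in> E" if i: "Suc i < length (p @ q)" for i
  proof -
    consider "Suc i < length p" | "Suc i = length p" | "length p \<le> i" by linarith
    then show ?thesis
    proof cases
      case 1
      then show ?thesis using assms(1) by (simp add: path_between_def nth_append)
    next
      case 2
      then have "(p @ q) ! i = last p" "(p @ q) ! Suc i = hd q"
        using assms(1,2) by (auto simp: path_between_def nth_append last_conv_nth hd_conv_nth simp flip: 2)
      then show ?thesis using assms by (simp add: path_between_def)
    next
      case 3
      then have "Suc (i - length p) < length q" using i by simp
      then have "{q ! (i - length p), q ! Suc (i - length p)} \<in> E"
        using assms(2) by (simp add: path_between_def)
      then show ?thesis using 3 by (simp add: nth_append Suc_diff_le)
    qed
  qed
  then show ?thesis using assms by (auto simp: path_between_def)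
qed

lemma path_between_singleton: "x \<in> V \<Longrightarrow> path_between V E x [x] x"
  by (simp add: path_between_def)

lemma path_between_mono: "path_between V E x p y \<Longrightarrow> V \<subseteq> V' \<Longrightarrow> path_between V' E x p y"
  by (auto simp: path_between_def)

text \<open>Makes reachability closed under edges although paths may not repeat vertices: if
  \<open>b\<close> already lies on \<open>p\<close>, the initial segment of \<open>p\<close> ending
  at \<open>b\<close> serves instead.\<close>

lemma path_between_extend:
  assumes "path_between V E x p a" "{a, b} \<in> E" "b \<in> V"
  shows "\<exists>q. path_between V E x q b"
proof (cases "b \<in> set p")
  case True
  then obtain i where i: "i < length p" "p ! i = b" by (auto simp: in_set_conv_nth)
  have "last (take (Suc i) p) = b" using i by (simp add: take_Suc_conv_app_nth)
  then have "path_between V E x (take (Suc i) p) b"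
    using assms(1) i set_take_subset[of "Suc i" p] by (auto simp: path_between_def)
  then show ?thesis by blast
next
  case False
  then have "path_between V E x (p @ [b]) b"
    using assms by (intro path_between_append[where y = a and x' = b] path_between_singleton) auto
  then show ?thesis by blast
qed

lemma simple_graph_edgeD:
  assumes "simple_graph V E" "{x, y} \<in> E"
  shows "x \<in> V" "y \<in> V" "x \<noteq> y"
  using assms unfolding simple_graph_def by (auto dest!: bspec)

lemma neighbors_subset: "simple_graph V E \<Longrightarrow> neighbors E x \<subseteq> V - {x}"
  unfolding neighbors_def by (auto dest: simple_graph_edgeD)

lemma finite_neighbors: "simple_graph V E \<Longrightarrow> finite (neighbors E x)"
  using neighbors_subset[of V E x] by (auto simp: simple_graph_def intro: finite_subset)

text \<open>The differences of the potential telescope along the path, and each is at most the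
  weight of its edge.\<close>

lemma path_weight_ge_potential_diff:
  assumes "path_between V E x p y"
    and "\<And>a b. {a, b} \<in> E \<Longrightarrow> f a - f b \<le> w {a, b}"
  shows "f x - f y \<le> path_weight w p"
proof -
  have p: "p \<noteq> []" "p ! 0 = x" "p ! (length p - 1) = y"
    using assms(1) by (auto simp: path_between_def hd_conv_nth last_conv_nth)
  have "f x - f y = (\<Sum>i<length p - 1. f (p ! i) - f (p ! Suc i))"
    using p sum_lessThan_telescope'[of "\<lambda>i. f (p ! i)" "length p - 1"] by simp
  also have "\<dots> \<le> (\<Sum>i<length p - 1. w {p ! i, p ! Suc i})"
    using assms by (intro sum_mono) (auto simp: path_between_def)
  finally show ?thesis by (simp add: path_weight_def)
qed

lemma graph_dist_ge_potential_diff: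
  assumes "connected_graph V E" "x \<in> V" "y \<in> V"
    and "\<And>a b. {a, b} \<in> E \<Longrightarrow> f a - f b \<le> w {a, b}"
  shows "f x - f y \<le> graph_dist V E w x y"
  unfolding graph_dist_def
  using assms path_weight_ge_potential_diff[of V E x _ y f w]
  by (intro cINF_greatest) (auto simp: connected_graph_def)

lemma graph_dist_le_path_weight:
  assumes "path_between V E x p y" and "\<And>h. h \<in> E \<Longrightarrow> 0 \<le> w h"
  shows "graph_dist V E w x y \<le> path_weight w p"
proof -
  \<comment> \<open>A real infimum requires a lower bound; the constant potential supplies
    0.\<close>
  have "0 \<le> path_weight w q" if "path_between V E x q y" for q
    using path_weight_ge_potential_diff[OF that, of "\<lambda>_. 0" w] assms(2) by simp
  then show ?thesis
    unfolding graph_dist_def using assms(1) by (intro cINF_lower bdd_belowI2[where m = 0]) auto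
qed

section \<open>Optimal transport\<close>

text \<open>The cost of a potential difference depends on the coupling only through its marginals,
  so one potential bounds all couplings at once.\<close>

lemma coupling_potential_sum:
  fixes f :: "'a \<Rightarrow> real"
  assumes "\<pi> \<in> couplings V \<mu> \<nu>"
  shows "(\<Sum>x\<in>V. \<Sum>y\<in>V. \<pi> x y * (f x - f y)) = (\<Sum>x\<in>V. \<mu> x * f x) - (\<Sum>y\<in>V. \<nu> y * f y)"
proof -
  have "(\<Sum>x\<in>V. \<Sum>y\<in>V. \<pi> x y * (f x - f y))
      = (\<Sum>x\<in>V. \<Sum>y\<in>V. \<pi> x y * f x) - (\<Sum>x\<in>V. \<Sum>y\<in>V. \<pi> x y * f y)"
    by (simp add: right_diff_distrib sum_subtractf)
  also have "(\<Sum>x\<in>V. \<Sum>y\<in>V. \<pi> x y * f y) = (\<Sum>y\<in>V. \<Sum>x\<in>V. \<pi> x y * f y)"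
    by (rule sum.swap)
  finally show ?thesis
    using assms by (simp add: couplings_def flip: sum_distrib_right)
qed

text \<open>Complementary slackness in Kantorovich duality: \<open>f\<close> bounds the cost of
  every coupling from below, and \<open>\<pi>\<close> meets this bound because it moves mass only
  between pairs where \<open>f\<close> attains the distance.\<close>

lemma transport_dist_eq_potential:
  fixes f :: "'a \<Rightarrow> real"
  assumes \<pi>: "\<pi> \<in> couplings V \<mu> \<nu>"
    and lip: "\<And>x y. x \<in> V \<Longrightarrow> y \<in> V \<Longrightarrow> f x - f y \<le> d x y"
    and tight: "\<And>x y. x \<in> V \<Longrightarrow> y \<in> V \<Longrightarrow> \<pi> x y \<noteq> 0 \<Longrightarrow> d x y \<le> f x - f y"
  shows "transport_dist V d \<mu> \<nu> = (\<Sum>x\<in>V. \<mu> x * f x) - (\<Sum>y\<in>V. \<nu> y * f y)" (is "_ = ?D")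
proof -
  have ge: "?D \<le> (\<Sum>x\<in>V. \<Sum>y\<in>V. \<rho> x y * d x y)" if "\<rho> \<in> couplings V \<mu> \<nu>" for \<rho>
    unfolding coupling_potential_sum[OF that, symmetric]
    using that lip by (intro sum_mono mult_left_mono) (auto simp: couplings_def)
  have "\<pi> x y * d x y = \<pi> x y * (f x - f y)" if "x \<in> V" "y \<in> V" for x y
    using lip[OF that] tight[OF that] by auto
  then have "(\<Sum>x\<in>V. \<Sum>y\<in>V. \<pi> x y * d x y) = ?D"
    unfolding coupling_potential_sum[OF \<pi>, symmetric] by (intro sum.cong) auto
  moreover have "transport_dist V d \<mu> \<nu> \<le> (\<Sum>x\<in>V. \<Sum>y\<in>V. \<pi> x y * d x y)"
    unfolding transport_dist_def using ge \<pi> by (intro cINF_lower bdd_belowI2[where m = ?D]) auto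
  moreover have "?D \<le> transport_dist V d \<mu> \<nu>"
    unfolding transport_dist_def using ge \<pi> by (intro cINF_greatest) auto
  ultimately show ?thesis by linarith
qed

section \<open>The random walk measures and a coupling along an edge\<close>

lemma inv_weight_sum_ge:
  assumes "simple_graph V E" "\<And>h. h \<in> E \<Longrightarrow> 0 < w h" "{x, y} \<in> E"
  shows "1 / w {x, y} \<le> inv_weight_sum E w x"
  unfolding inv_weight_sum_def
  using assms by (intro member_le_sum finite_neighbors) (auto simp: neighbors_def intro: less_imp_le)

lemma inv_weight_sum_pos:
  assumes "simple_graph V E" "\<And>h. h \<in> E \<Longrightarrow> 0 < w h" "{x, y} \<in> E"
  shows "0 < inv_weight_sum E w x"
  using inv_weight_sum_ge[where w = w, OF assms] assms(2)[OF assms(3)]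
  by (smt (verit) zero_less_divide_1_iff)

lemma sum_walk_measure:
  assumes G: "simple_graph V E" and "x \<in> V"
  shows "(\<Sum>y\<in>V. walk_measure E w \<alpha> x y * F y)
       = \<alpha> * F x + (1 - \<alpha>) * (\<Sum>z\<in>neighbors E x. F z / w {x, z}) / inv_weight_sum E w x"
proof -
  have "finite V" using G by (simp add: simple_graph_def)
  have "(\<Sum>y\<in>V. walk_measure E w \<alpha> x y * F y)
      = \<alpha> * F x + (\<Sum>y\<in>V - {x}. walk_measure E w \<alpha> x y * F y)"
    using \<open>finite V\<close> \<open>x \<in> V\<close> by (simp add: sum.remove walk_measure_def)
  also have "(\<Sum>y\<in>V - {x}. walk_measure E w \<alpha> x y * F y)
      = (\<Sum>y\<in>neighbors E x. walk_measure E w \<alpha> x y * F y)"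
    using \<open>finite V\<close> neighbors_subset[OF G] by (intro sum.mono_neutral_right) (auto simp: walk_measure_def)
  also have "\<dots> = (\<Sum>y\<in>neighbors E x. (1 - \<alpha>) * (F y / w {x, y}) / inv_weight_sum E w x)"
    using neighbors_subset[OF G, of x] by (intro sum.cong) (auto simp: walk_measure_def)
  finally show ?thesis by (simp add: sum_distrib_left sum_divide_distrib)
qed

text \<open>All mass of \<open>\<mu>\<close> off \<open>u\<close>, in total
  \<open>1 - \<alpha>\<close>, goes to \<open>v\<close>; all mass of \<open>\<nu>\<close> off
  \<open>v\<close>, again \<open>1 - \<alpha>\<close>, comes from \<open>u\<close>. This leaves
  \<open>2 * \<alpha> - 1\<close> to move from \<open>u\<close> to \<open>v\<close>, which is
  nonnegative as \<open>1 / 2 \<le> \<alpha>\<close>.\<close>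

lemma edge_coupling:
  assumes G: "simple_graph V E" and w: "\<And>h. h \<in> E \<Longrightarrow> 0 < w h"
    and uv: "{u, v} \<in> E" and \<alpha>: "1 / 2 \<le> \<alpha>" "\<alpha> \<le> 1"
  defines "\<mu> \<equiv> walk_measure E w \<alpha> u" and "\<nu> \<equiv> walk_measure E w \<alpha> v"
  shows "(\<lambda>x y. if x = u then if y = v then 2 * \<alpha> - 1 else \<nu> y
            else if y = v then \<mu> x else 0) \<in> couplings V \<mu> \<nu>" (is "?\<pi> \<in> _")
proof -
  have V: "finite V" "u \<in> V" "v \<in> V" "u \<noteq> v"
    using G simple_graph_edgeD[OF G uv] by (auto simp: simple_graph_def)
  have vu: "{v, u} \<in> E" using uv by (simp add: insert_commute)
  have D: "0 < inv_weight_sum E w u" "0 < inv_weight_sum E w v"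
    using inv_weight_sum_pos[where w = w, OF G w] uv vu by auto
  have nn: "0 \<le> \<mu> x" "0 \<le> \<nu> x" for x
    using \<alpha> D w by (auto simp: \<mu>_def \<nu>_def walk_measure_def neighbors_def less_imp_le)
  have diag: "\<mu> u = \<alpha>" "\<nu> v = \<alpha>" by (simp_all add: \<mu>_def \<nu>_def walk_measure_def)
  have "(\<Sum>y\<in>V. \<mu> y) = 1" "(\<Sum>y\<in>V. \<nu> y) = 1"
    using sum_walk_measure[OF G, of _ w \<alpha> "\<lambda>_. 1"] D V
    by (auto simp: \<mu>_def \<nu>_def simp flip: inv_weight_sum_def)
  then have rest: "sum \<mu> (V - {u}) = 1 - \<alpha>" "sum \<nu> (V - {v}) = 1 - \<alpha>"
    using V diag by (simp_all add: sum_diff1)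
  have row: "(\<Sum>y\<in>V. ?\<pi> x y) = \<mu> x" if "x \<in> V" for x
  proof (cases "x = u")
    case True
    have "(\<Sum>y\<in>V. ?\<pi> x y) = 2 * \<alpha> - 1 + (\<Sum>y\<in>V - {v}. ?\<pi> x y)"
      using V True sum.remove[of V v "?\<pi> x"] by simp
    also have "(\<Sum>y\<in>V - {v}. ?\<pi> x y) = sum \<nu> (V - {v})"
      using True by (intro sum.cong) auto
    finally show ?thesis using True rest diag by simp
  next
    case False
    then show ?thesis using V by simp
  qed
  have col: "(\<Sum>x\<in>V. ?\<pi> x y) = \<nu> y" if "y \<in> V" for y
  proof (cases "y = v")
    case True
    have "(\<Sum>x\<in>V. ?\<pi> x y) = 2 * \<alpha> - 1 + (\<Sum>x\<in>V - {u}. ?\<pi> x y)"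
      using V True sum.remove[of V u "\<lambda>x. ?\<pi> x y"] by simp
    also have "(\<Sum>x\<in>V - {u}. ?\<pi> x y) = sum \<mu> (V - {u})"
      using True by (intro sum.cong) auto
    finally show ?thesis using True rest diag by simp
  next
    case False
    then show ?thesis using V by (simp cong: if_cong)
  qed
  show ?thesis
    unfolding couplings_def using row col nn \<alpha> by auto
qed

section \<open>Curvature of a tree edge\<close>

text \<open>The signed distance from \<open>u\<close>, positive on the side of \<open>u\<close> and
  negative on the side of \<open>v\<close>, is truncated here: it stays constant beyond the
  neighbours of \<open>u\<close> and \<open>v\<close>. The measures only see those vertices, and
  constancy makes the bound trivial on all other edges.\<close>

lemma tree_edge_potential:
  assumes T: "tree V E" and w: "\<And>h. h \<in> E \<Longrightarrow> 0 < w h" and uv: "{u, v} \<in> E"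
  obtains f :: "'a \<Rightarrow> real" where
    "f u = 0" "f v = - w {u, v}"
    "\<And>z. z \<in> neighbors E u - {v} \<Longrightarrow> f z = w {u, z}"
    "\<And>z. z \<in> neighbors E v - {u} \<Longrightarrow> f z = - w {u, v} - w {v, z}"
    "\<And>a b. {a, b} \<in> E \<Longrightarrow> f a - f b \<le> w {a, b}"
proof -
  have G: "simple_graph V E" and ac: "acyclic_graph V E" using T by (auto simp: tree_def)
  have V: "u \<in> V" "v \<in> V" "u \<noteq> v" using simple_graph_edgeD[OF G uv] by auto
  have vu: "{v, u} \<in> E" using uv by (simp add: insert_commute)
  define U where "U = V - {u, v}"
  \<comment> \<open>\<open>R z x\<close> means that \<open>z\<close> and \<open>x\<close> lie in one
    component of the tree with \<open>u\<close> and \<open>v\<close> removed.\<close>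
  define R where "R z x \<longleftrightarrow> (\<exists>p. path_between U E z p x)" for z x
  define A B where "A = neighbors E u - {v}" and "B = neighbors E v - {u}"
  have AB: "A \<subseteq> U" "B \<subseteq> U" "finite A" "finite B"
    using neighbors_subset[OF G] finite_neighbors[OF G] by (auto simp: A_def B_def U_def)
  have R_in: "z \<in> U \<and> x \<in> U" if "R z x" for z x
    using that unfolding R_def path_between_def by fastforce
  have R_refl: "R z z" if "z \<in> U" for z
    using that path_between_singleton unfolding R_def by fast
  have R_step: "R z b" if "R z a" "{a, b} \<in> E" "b \<in> U" for z a b
    using that path_between_extend unfolding R_def by fast
  \<comment> \<open>Two distinct neighbours of \<open>c\<close> in one component would close a cycle
    through \<open>c\<close>.\<close>
  have same: "z = z'" if R: "R z z'" and z: "{c, z} \<in> E" "{c, z'} \<in> E" and c: "c = u \<or> c = v" for c z z'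
  proof (rule ccontr)
    assume ne: "z \<noteq> z'"
    from R obtain p where p: "path_between U E z p z'" by (auto simp: R_def)
    have "path_between V E c ([c] @ p) z'"
    proof (rule path_between_append)
      show "path_between V E c [c] c" using c V by (auto intro: path_between_singleton)
      show "path_between V E z p z'" using p by (rule path_between_mono) (auto simp: U_def)
      show "set [c] \<inter> set p = {}" using p c by (auto simp: path_between_def U_def)
    qed (rule z)
    moreover have "2 \<le> length p" using p ne
      by (cases p; cases "tl p") (auto simp: path_between_def)
    moreover have "{z', c} \<in> E" using z by (simp add: insert_commute)
    ultimately show False using ac unfolding acyclic_graph_def by fastforce
  qed
  \<comment> \<open>A component adjacent to both \<open>u\<close> and \<open>v\<close> would close a
    cycle with the edge \<open>{u, v}\<close>.\<close>
  have apart: False if R: "R z z'" and z: "{u, z} \<in> E" "{v, z'} \<in> E" for z z'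
  proof -
    from R obtain p where p: "path_between U E z p z'" by (auto simp: R_def)
    have "path_between V E u ([u] @ (p @ [v])) v"
    proof (intro path_between_append)
      show "path_between V E u [u] u" "path_between V E v [v] v"
        using V by (auto intro: path_between_singleton)
      show "path_between V E z p z'" using p by (rule path_between_mono) (auto simp: U_def)
      show "{z', v} \<in> E" using z by (simp add: insert_commute)
    qed (use p z V in \<open>auto simp: path_between_def U_def\<close>)
    moreover have "1 \<le> length p" using p by (cases p) (auto simp: path_between_def)
    ultimately show False using ac vu unfolding acyclic_graph_def by fastforce
  qed
  have R_sym: "R z' z" if "R z z'" for z z'
  proof -
    from that obtain p where p: "path_between U E z p z'" by (auto simp: R_def)
    have "path_between U E z' (rev p) z"
      unfolding path_between_def
    proof (intro conjI allI impI)
      fix i assume i: "Suc i < length (rev p)"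
      then have "{p ! (length p - Suc (Suc i)), p ! Suc (length p - Suc (Suc i))} \<in> E"
        using p by (simp add: path_between_def)
      then show "{rev p ! i, rev p ! Suc i} \<in> E"
        using i by (simp add: rev_nth Suc_diff_Suc insert_commute)
    qed (use p in \<open>auto simp: path_between_def hd_rev last_rev\<close>)
    then show ?thesis unfolding R_def by blast
  qed
  (* Since the graph is acyclic, at most one neighbour z of u or v reaches x outside {u, v};
     so the two sums have at most one term altogether. *)
  define f where "f x = (if x = u then 0 else if x = v then - w {u, v}
      else (\<Sum>z\<in>{z\<in>A. R z x}. w {u, z}) - (\<Sum>z\<in>{z\<in>B. R z x}. w {u, v} + w {v, z}))" for x
  have fu: "f u = 0" and fv: "f v = - w {u, v}" using V by (auto simp: f_def)
  have fA: "f z = w {u, z}" if z: "z \<in> A" for z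
  proof -
    have 1: "{y\<in>A. R y z} = {z}"
      using z same[of _ z u] R_refl AB by (auto simp: A_def neighbors_def)
    have 2: "{y\<in>B. R y z} = {}"
      using z apart R_sym by (auto simp: A_def B_def neighbors_def)
    have "z \<noteq> u" "z \<noteq> v" using z AB by (auto simp: U_def)
    then show ?thesis unfolding f_def 1 2 by simp
  qed
  have fB: "f z = - w {u, v} - w {v, z}" if z: "z \<in> B" for z
  proof -
    have 1: "{y\<in>B. R y z} = {z}"
      using z same[of _ z v] R_refl AB by (auto simp: B_def neighbors_def)
    have 2: "{y\<in>A. R y z} = {}"
      using z apart by (auto simp: A_def B_def neighbors_def)
    have "z \<noteq> u" "z \<noteq> v" using z AB by (auto simp: U_def)
    then show ?thesis unfolding f_def 1 2 by simp
  qed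
  \<comment> \<open>The ends of such an edge share a component, so both sums in \<open>f\<close>
    range over the same neighbours.\<close>
  have const: "f a = f b" if ab: "{a, b} \<in> E" "a \<notin> {u, v}" "b \<notin> {u, v}" for a b
  proof -
    have "a \<in> U" "b \<in> U" using ab simple_graph_edgeD[OF G ab(1)] by (auto simp: U_def)
    then have "R z a \<longleftrightarrow> R z b" for z
      using R_step[of z a b] R_step[of z b a] ab(1) by (auto simp: insert_commute)
    then show ?thesis using ab by (simp add: f_def)
  qed
  have lip: "f a - f b \<le> w {a, b}" if ab: "{a, b} \<in> E" for a b
  proof -
    have ba: "{b, a} \<in> E" using ab by (simp add: insert_commute)
    have ne: "a \<noteq> b" using simple_graph_edgeD[OF G ab] by simp
    have pos: "0 < w {a, b}" "0 < w {b, a}" "0 < w {u, v}" "0 < w {v, u}"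
      using w ab ba uv vu by auto
    have comm: "w {a, b} = w {b, a}" "w {u, v} = w {v, u}" by (simp_all add: insert_commute)
    \<comment> \<open>The absolute value serves both orientations of an edge that meets
      \<open>u\<close> or \<open>v\<close>.\<close>
    have edge: "\<bar>f c - f z\<bar> = w {c, z}" if "{c, z} \<in> E" "c \<in> {u, v}" for c z
    proof -
      have "c \<noteq> z" using simple_graph_edgeD[OF G that(1)] by simp
      with that consider "c = u" "z = v" | "c = v" "z = u" | "c = u" "z \<in> A" | "c = v" "z \<in> B"
        by (auto simp: A_def B_def neighbors_def)
      then show ?thesis
        using fu fv fA fB comm pos w[OF that(1)] by cases auto
    qed
    consider "a \<in> {u, v}" | "b \<in> {u, v}" | "a \<notin> {u, v}" "b \<notin> {u, v}" by blast
    then show ?thesis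
    proof cases
      case 1 then show ?thesis using edge[OF ab] by linarith
    next
      case 2 then show ?thesis using edge[OF ba] comm by linarith
    next
      case 3 then show ?thesis using const[OF ab] pos by simp
    qed
  qed
  show thesis
    using that[of f] fu fv fA fB lip by (auto simp: A_def B_def)
qed

text \<open>The coupling of \<open>edge_coupling\<close> and the potential of
  \<open>tree_edge_potential\<close> certify each other's optimality, so the transport distance is
  the difference of the integrals of \<open>f\<close>.\<close>

lemma tree_transport_dist:
  assumes T: "tree V E" and w: "\<And>h. h \<in> E \<Longrightarrow> 0 < w h" and uv: "{u, v} \<in> E"
    and \<alpha>: "1 / 2 \<le> \<alpha>" "\<alpha> \<le> 1"
  shows "transport_dist V (graph_dist V E w) (walk_measure E w \<alpha> u) (walk_measure E w \<alpha> v)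
       = w {u, v} - (1 - \<alpha>) * ((2 - real (degree E u)) / inv_weight_sum E w u
                              + (2 - real (degree E v)) / inv_weight_sum E w v)"
    and "graph_dist V E w u v = w {u, v}"
proof -
  have G: "simple_graph V E" and conn: "connected_graph V E" using T by (auto simp: tree_def)
  have V: "u \<in> V" "v \<in> V" "u \<noteq> v" using simple_graph_edgeD[OF G uv] by auto
  have vu: "{v, u} \<in> E" using uv by (simp add: insert_commute)
  have w0: "\<And>h. h \<in> E \<Longrightarrow> 0 \<le> w h" using w less_imp_le by blast
  have wuv: "0 < w {u, v}" "w {v, u} = w {u, v}" using w[OF uv] by (auto simp: insert_commute)
  have D: "0 < inv_weight_sum E w u" "0 < inv_weight_sum E w v"
    using inv_weight_sum_pos[where w = w, OF G w] uv vu by auto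
  obtain f :: "'a \<Rightarrow> real" where f: "f u = 0" "f v = - w {u, v}"
    and fA: "\<And>z. z \<in> neighbors E u - {v} \<Longrightarrow> f z = w {u, z}"
    and fB: "\<And>z. z \<in> neighbors E v - {u} \<Longrightarrow> f z = - w {u, v} - w {v, z}"
    and lipE: "\<And>a b. {a, b} \<in> E \<Longrightarrow> f a - f b \<le> w {a, b}"
    using tree_edge_potential[where w = w, OF T w uv] by blast
  have lip: "f x - f y \<le> graph_dist V E w x y" if "x \<in> V" "y \<in> V" for x y
    using graph_dist_ge_potential_diff[OF conn that, of f w] lipE by blast
  \<comment> \<open>The coupling moves mass only out of \<open>u\<close> or into \<open>v\<close>,
    so paths with at most three vertices bound all relevant distances from above.\<close>
  have p1: "path_between V E x [x] x" if "x \<in> V" for x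
    using that by (rule path_between_singleton)
  have p2: "path_between V E x [x, y] y" if "{x, y} \<in> E" for x y
    using simple_graph_edgeD[OF G that] that by (auto simp: path_between_def)
  have p3: "path_between V E x [x, y, z] z" if "{x, y} \<in> E" "{y, z} \<in> E" "x \<noteq> z" for x y z
    using simple_graph_edgeD[OF G that(1)] simple_graph_edgeD[OF G that(2)] that
    by (auto simp: path_between_def less_Suc_eq)
  have d1: "graph_dist V E w x x \<le> 0" if "x \<in> V" for x
    using graph_dist_le_path_weight[OF p1[OF that], of w] w0 by (simp add: path_weight_def)
  have d2: "graph_dist V E w x y \<le> w {x, y}" if "{x, y} \<in> E" for x y
    using graph_dist_le_path_weight[OF p2[OF that], of w] w0 by (simp add: path_weight_def)
  have d3: "graph_dist V E w x z \<le> w {x, y} + w {y, z}" if "{x, y} \<in> E" "{y, z} \<in> E" "x \<noteq> z" for x y z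
    using graph_dist_le_path_weight[OF p3[OF that], of w] w0
    by (simp add: path_weight_def numeral_2_eq_2)
  show "graph_dist V E w u v = w {u, v}"
    using lip[OF V(1,2)] d2[OF uv] f by simp
  define \<mu> \<nu> where "\<mu> = walk_measure E w \<alpha> u" and "\<nu> = walk_measure E w \<alpha> v"
  \<comment> \<open>Tightness for mass sent to \<open>v\<close>: such an \<open>x\<close> is
    \<open>v\<close> itself or another neighbour of \<open>u\<close>, and then the route through
    \<open>u\<close> has weight \<open>f x - f v\<close>.\<close>
  have "graph_dist V E w x v \<le> f x - f v" if "x \<in> V" "x \<noteq> u" "\<mu> x \<noteq> 0" for x
  proof (cases "x = v")
    case True then show ?thesis using d1[OF V(2)] by simp
  next
    case False
    then have x: "x \<in> neighbors E u - {v}"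
      using that by (auto simp: \<mu>_def walk_measure_def split: if_splits)
    then show ?thesis
      using d3[of x u v] fA[OF x] f uv by (simp add: neighbors_def insert_commute)
  qed
  moreover have "graph_dist V E w u y \<le> f u - f y" if "y \<in> V" "y \<noteq> v" "\<nu> y \<noteq> 0" for y
  proof (cases "y = u")
    case True then show ?thesis using d1[OF V(1)] by simp
  next
    case False
    then have y: "y \<in> neighbors E v - {u}"
      using that by (auto simp: \<nu>_def walk_measure_def split: if_splits)
    then show ?thesis
      using d3[of u v y] fB[OF y] f uv by (auto simp: neighbors_def)
  qed
  moreover have "graph_dist V E w u v \<le> f u - f v" using d2[OF uv] f by simp
  ultimately have "transport_dist V (graph_dist V E w) \<mu> \<nu> = (\<Sum>x\<in>V. \<mu> x * f x) - (\<Sum>y\<in>V. \<nu> y * f y)"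
    using lip unfolding \<mu>_def \<nu>_def
    by (intro transport_dist_eq_potential[OF edge_coupling[OF G w uv \<alpha>]]) (auto split: if_splits)
  moreover have "(\<Sum>x\<in>V. \<mu> x * f x) = - ((1 - \<alpha>) * ((2 - real (degree E u)) / inv_weight_sum E w u))"
  proof -
    have v: "v \<in> neighbors E u" using uv by (simp add: neighbors_def)
    \<comment> \<open>The neighbour \<open>v\<close> contributes -1 and each of the other
      \<open>degree E u - 1\<close> neighbours contributes 1.\<close>
    have "(\<Sum>z\<in>neighbors E u. f z / w {u, z}) = -1 + (\<Sum>z\<in>neighbors E u - {v}. f z / w {u, z})"
      using v wuv f by (simp add: sum.remove[OF finite_neighbors[OF G] v])
    also have "(\<Sum>z\<in>neighbors E u - {v}. f z / w {u, z}) = (\<Sum>z\<in>neighbors E u - {v}. 1)"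
    proof (rule sum.cong[OF refl])
      fix z assume z: "z \<in> neighbors E u - {v}"
      then have "0 < w {u, z}" using w by (simp add: neighbors_def)
      then show "f z / w {u, z} = 1" using fA[OF z] by simp
    qed
    also have "\<dots> = real (degree E u) - 1"
      using v card_gt_0_iff[of "neighbors E u"] finite_neighbors[OF G, of u]
      by (auto simp: degree_def of_nat_diff Suc_le_eq)
    finally have S: "(\<Sum>z\<in>neighbors E u. f z / w {u, z}) = real (degree E u) - 2" by simp
    show ?thesis
      unfolding \<mu>_def sum_walk_measure[OF G V(1)] f(1) S
      by (simp add: algebra_simps diff_divide_distrib add_divide_distrib)
  qed
  moreover have "(\<Sum>y\<in>V. \<nu> y * f y)
      = - w {u, v} + (1 - \<alpha>) * ((2 - real (degree E v)) / inv_weight_sum E w v)"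
  proof -
    have u: "u \<in> neighbors E v" using vu by (simp add: neighbors_def)
    \<comment> \<open>The term for \<open>u\<close> vanishes as \<open>f u = 0\<close>. The
      remaining sum contains \<open>- w {u, v} * inv_weight_sum E w v\<close>; after averaging, this
      joins \<open>\<alpha> * f v\<close> to give \<open>- w {u, v}\<close> for every
      \<open>\<alpha>\<close>.\<close>
    have "(\<Sum>z\<in>neighbors E v. f z / w {v, z}) = (\<Sum>z\<in>neighbors E v - {u}. f z / w {v, z})"
      using f by (simp add: sum.remove[OF finite_neighbors[OF G] u])
    also have "\<dots> = (\<Sum>z\<in>neighbors E v - {u}. - w {u, v} * (1 / w {v, z}) - 1)"
    proof (rule sum.cong[OF refl])
      fix z assume z: "z \<in> neighbors E v - {u}"
      then have "0 < w {v, z}" using w by (simp add: neighbors_def)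
      then show "f z / w {v, z} = - w {u, v} * (1 / w {v, z}) - 1"
        using fB[OF z] by (simp add: field_simps)
    qed
    also have "\<dots> = - w {u, v} * (\<Sum>z\<in>neighbors E v - {u}. 1 / w {v, z}) - (real (degree E v) - 1)"
      using u card_gt_0_iff[of "neighbors E v"] finite_neighbors[OF G, of v]
      by (auto simp: sum_subtractf sum_distrib_left degree_def of_nat_diff Suc_le_eq simp flip: sum_negf)
    also have "(\<Sum>z\<in>neighbors E v - {u}. 1 / w {v, z}) = inv_weight_sum E w v - 1 / w {u, v}"
      unfolding inv_weight_sum_def using u finite_neighbors[OF G, of v] wuv
      by (simp add: sum_diff1)
    finally have S: "(\<Sum>z\<in>neighbors E v. f z / w {v, z})
        = 2 - real (degree E v) - w {u, v} * inv_weight_sum E w v"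
      using wuv by (simp add: algebra_simps)
    show ?thesis
      unfolding \<nu>_def sum_walk_measure[OF G V(2)] f(2) S using D
      by (simp add: field_simps)
  qed
  ultimately show "transport_dist V (graph_dist V E w) (walk_measure E w \<alpha> u) (walk_measure E w \<alpha> v)
       = w {u, v} - (1 - \<alpha>) * ((2 - real (degree E u)) / inv_weight_sum E w u
                              + (2 - real (degree E v)) / inv_weight_sum E w v)"
    by (simp add: \<mu>_def \<nu>_def algebra_simps)
qed

text \<open>The difference quotient does not depend on \<open>\<alpha>\<close> once
  \<open>1 / 2 < \<alpha> < 1\<close>, so its limit is immediate. The product with the weight is the
  form that enters the flow.\<close>

lemma tree_curvature:
  assumes T: "tree V E" and w: "\<And>h. h \<in> E \<Longrightarrow> 0 < w h" and uv: "{u, v} \<in> E"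
  shows "curvature V E w u v * w {u, v}
       = (2 - real (degree E u)) / inv_weight_sum E w u + (2 - real (degree E v)) / inv_weight_sum E w v"
    (is "_ = ?K")
proof -
  have "0 < w {u, v}" using w[OF uv] .
  have "curvature_alpha V E w \<alpha> u v / (1 - \<alpha>) = ?K / w {u, v}" if "1 / 2 < \<alpha>" "\<alpha> < 1" for \<alpha>
    using tree_transport_dist[where w = w and \<alpha> = \<alpha>, OF T w uv] that \<open>0 < w {u, v}\<close>
    by (simp add: curvature_alpha_def diff_divide_distrib)
  then have "eventually (\<lambda>\<alpha>. curvature_alpha V E w \<alpha> u v / (1 - \<alpha>) = ?K / w {u, v}) (at_left 1)"
    by (intro eventually_at_leftI[of "1 / 2"]) auto
  then have "((\<lambda>\<alpha>. curvature_alpha V E w \<alpha> u v / (1 - \<alpha>)) \<longlongrightarrow> ?K / w {u, v}) (at_left 1)"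
    by (rule tendsto_eventually)
  then have "curvature V E w u v = ?K / w {u, v}"
    unfolding curvature_def by (intro tendsto_Lim trivial_limit_at_left_real)
  then show ?thesis using \<open>0 < w {u, v}\<close> by simp
qed

section \<open>The flow\<close>

text \<open>A mean value inequality for one-sided derivatives at 0: only continuity is used at the
  ends of the interval, and at interior points the derivative is two-sided.\<close>

lemma half_line_increment_ge:
  fixes f :: "real \<Rightarrow> real"
  assumes f: "\<And>t. 0 \<le> t \<Longrightarrow> (f has_real_derivative f' t) (at t within {0..})"
    and c: "\<And>t. 0 \<le> t \<Longrightarrow> c \<le> f' t" and "0 \<le> t"
  shows "f 0 + c * t \<le> f t"
proof -
  have "(\<lambda>s. f s - c * s) 0 \<le> (\<lambda>s. f s - c * s) t"
  proof (rule DERIV_nonneg_imp_increasing_open[OF \<open>0 \<le> t\<close>])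
    fix s :: real assume s: "0 < s" "s < t"
    have "(f has_real_derivative f' s) (at s within {0<..})"
      using f[of s] s by (auto intro: has_field_derivative_subset)
    then have "(f has_real_derivative f' s) (at s)"
      using s by (simp add: at_within_open[of _ "{0<..}"])
    then have "((\<lambda>s. f s - c * s) has_real_derivative f' s - c) (at s)"
      by (auto intro!: derivative_eq_intros)
    then show "\<exists>y. ((\<lambda>s. f s - c * s) has_real_derivative y) (at s) \<and> 0 \<le> y"
      using c[of s] s by force
  next
    have "continuous_on {0..t} f"
      unfolding continuous_on_eq_continuous_within
      using DERIV_continuous[OF has_field_derivative_subset[OF f]] by fastforce
    then show "continuous_on {0..t} (\<lambda>s. f s - c * s)"
      by (intro continuous_intros)
  qed
  then show ?thesis by simp
qed

section \<open>Flow equations on a tree and the resulting estimates\<close>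

lemma tree_flow_equation:
  assumes T: "tree V E" and R: "ricci_flow V E w" and uv: "{u, v} \<in> E" and t: "0 \<le> t"
  shows "((\<lambda>s. w s {u, v}) has_real_derivative
           (real (degree E u) - 2) / inv_weight_sum E (w t) u + (real (degree E v) - 2) / inv_weight_sum E (w t) v)
           (at t within {0..})"
proof -
  have "- curvature V E (w t) u v * w t {u, v}
      = (real (degree E u) - 2) / inv_weight_sum E (w t) u + (real (degree E v) - 2) / inv_weight_sum E (w t) v"
    using tree_curvature[OF T, of "w t" u v] R uv t
    by (simp add: ricci_flow_def diff_divide_distrib)
  then show ?thesis using R uv t unfolding ricci_flow_def by metis
qed

text \<open>The integrating factor that absorbs the decay term \<open>- w\<close> in the equations
  for edges.\<close>

lemma has_real_derivative_exp_times:
  assumes "(f has_real_derivative d) (at t within S)"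
  shows "((\<lambda>s. exp s * f s) has_real_derivative exp t * (d + f t)) (at t within S)"
  using assms by (auto intro!: derivative_eq_intros simp: algebra_simps)

lemma degree_1_neighbors:
  assumes "degree E a = 1" "{u, a} \<in> E"
  shows "neighbors E a = {u}"
proof -
  have "u \<in> neighbors E a" using assms(2) by (simp add: neighbors_def insert_commute)
  with assms(1) show ?thesis by (auto simp: degree_def card_1_singleton_iff)
qed

text \<open>At the leaf \<open>a\<close> the only neighbour is \<open>u\<close>, so that end
  contributes exactly \<open>- w t {u, a}\<close>, which the factor \<open>exp\<close> cancels. What
  remains depends on \<open>u\<close> alone and is shared by all leaf edges at
  \<open>u\<close>.\<close>

lemma leaf_flow_equation:
  assumes T: "tree V E" and R: "ricci_flow V E w" and ua: "{u, a} \<in> E" and a: "degree E a = 1" and t: "0 \<le> t"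
  shows "((\<lambda>s. exp s * w s {u, a}) has_real_derivative
           exp t * ((real (degree E u) - 2) / inv_weight_sum E (w t) u)) (at t within {0..})"
proof -
  have "inv_weight_sum E (w t) a = 1 / w t {u, a}"
    unfolding inv_weight_sum_def degree_1_neighbors[OF a ua] by (simp add: insert_commute)
  then show ?thesis
    using has_real_derivative_exp_times[OF tree_flow_equation[OF T R ua t]] a
    by simp
qed

text \<open>For each edge at \<open>u\<close>, the end \<open>u\<close> contributes a nonnegative
  term as its degree is at least 2, and the other end \<open>z\<close> contributes at least
  \<open>- w\<close>, since its degree is at least 1 and \<open>1 / w\<close> is one summand of its
  inverse weight sum. Hence \<open>exp t * w\<close> does not decrease.\<close>

lemma flow_inv_weight_sum_le:
  assumes T: "tree V E" and R: "ricci_flow V E w" and u: "2 \<le> degree E u" and t: "0 \<le> t"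
  shows "inv_weight_sum E (w t) u \<le> exp t * inv_weight_sum E (w 0) u"
proof -
  have G: "simple_graph V E" using T by (simp add: tree_def)
  have pos: "0 < w s h" if "0 \<le> s" "h \<in> E" for s h using R that by (simp add: ricci_flow_def)
  have "1 / w t {u, z} \<le> exp t * (1 / w 0 {u, z})" if z: "z \<in> neighbors E u" for z
  proof -
    have uz: "{u, z} \<in> E" "{z, u} \<in> E" using z by (auto simp: neighbors_def insert_commute)
    have nonneg: "0 \<le> exp s * ((real (degree E u) - 2) / inv_weight_sum E (w s) u
        + (real (degree E z) - 2) / inv_weight_sum E (w s) z + w s {u, z})" if s: "0 \<le> s" for s
    proof -
      let ?D = "inv_weight_sum E (w s)"
      have D: "0 < ?D u" "0 < ?D z"
        using inv_weight_sum_pos[where w = "w s", OF G pos[OF s]] uz by blast+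
      have "1 / w s {u, z} \<le> ?D z"
        using inv_weight_sum_ge[where w = "w s", OF G pos[OF s] uz(2)] by (simp add: insert_commute)
      have "1 \<le> degree E z"
        using uz finite_neighbors[OF G, of z] by (auto simp: degree_def Suc_le_eq card_gt_0_iff neighbors_def)
      then have "- (1 / ?D z) \<le> (real (degree E z) - 2) / ?D z"
        using D by (simp add: field_simps)
      moreover have "1 / ?D z \<le> w s {u, z}"
        using D \<open>1 / w s {u, z} \<le> ?D z\<close> pos[OF s uz(1)] by (simp add: field_simps)
      moreover have "0 \<le> (real (degree E u) - 2) / ?D u" using D u by simp
      ultimately show ?thesis by simp
    qed
    have "w 0 {u, z} \<le> exp t * w t {u, z}"
      using half_line_increment_ge[OF has_real_derivative_exp_times[OF tree_flow_equation[OF T R uz(1)]] nonneg t]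
      by simp
    then show ?thesis using pos[OF t uz(1)] pos[of 0, OF _ uz(1)] by (simp add: field_simps)
  qed
  then show ?thesis
    unfolding inv_weight_sum_def sum_distrib_left by (intro sum_mono)
qed

text \<open>Used to exclude degree 2 at the common vertex. A path from \<open>u\<close> with a third
  vertex would have to leave \<open>a\<close> or \<open>b\<close> towards a vertex other than
  \<open>u\<close>, so by connectedness only \<open>u\<close>, \<open>a\<close> and \<open>b\<close>
  exist.\<close>

lemma two_leaves_star:
  assumes T: "tree V E" and N: "neighbors E u = {a, b}"
    and a: "neighbors E a = {u}" and b: "neighbors E b = {u}"
  shows "star_graph V E"
proof -
  have G: "simple_graph V E" and conn: "connected_graph V E" using T by (auto simp: tree_def)
  have "{u, a} \<in> E" using N by (auto simp: neighbors_def)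
  then have uV: "u \<in> V" using simple_graph_edgeD[OF G] by blast
  have "x \<in> {u, a, b}" if x: "x \<in> V" for x
  proof -
    obtain p where p: "path_between V E u p x" using conn uV x by (auto simp: connected_graph_def)
    show ?thesis
    proof (cases "length p \<le> 2")
      case True
      with p have "p = [u] \<and> x = u \<or> p = [u, x] \<and> {u, x} \<in> E"
        by (cases p; cases "tl p") (auto simp: path_between_def)
      then show ?thesis using N by (auto simp: neighbors_def)
    next
      case False
      then have "Suc 0 < length p" "Suc 1 < length p" by auto
      then have "{p ! 0, p ! 1} \<in> E" "{p ! 1, p ! 2} \<in> E" "p ! 0 = u" "p ! 0 \<noteq> p ! 2"
        using p unfolding path_between_def
        by (auto simp: numeral_2_eq_2 hd_conv_nth nth_eq_iff_index_eq)
      then have "p ! 1 \<in> neighbors E u" "p ! 2 \<in> neighbors E (p ! 1)" "p ! 2 \<noteq> u"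
        by (auto simp: neighbors_def)
      then show ?thesis using N a b by auto
    qed
  qed
  then have V: "V \<subseteq> {u, a, b}" by blast
  have "E = {{u, v} | v. v \<in> V - {u}}"
  proof (intro set_eqI iffI)
    fix h assume h: "h \<in> E"
    then have "card h = 2" using G by (simp add: simple_graph_def)
    then obtain x y where xy: "h = {x, y}" "x \<noteq> y" by (auto simp: card_2_iff)
    have xyV: "x \<in> V" "y \<in> V" using simple_graph_edgeD[OF G] h xy by auto
    have "u \<in> h"
    proof (rule ccontr)
      assume "u \<notin> h"
      then have "x \<in> {a, b}" "y \<noteq> u" using xy xyV V by auto
      moreover have "y \<in> neighbors E x" using h xy by (simp add: neighbors_def)
      ultimately show False using a b by auto
    qed
    then show "h \<in> {{u, v} | v. v \<in> V - {u}}" using xy xyV by auto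
  next
    fix h assume "h \<in> {{u, v} | v. v \<in> V - {u}}"
    then obtain v where "h = {u, v}" "v \<in> {a, b}" using V by auto
    then show "h \<in> E" using N by (auto simp: neighbors_def)
  qed
  then show ?thesis unfolding star_graph_def using uV by blast
qed

theorem proposition2:
  fixes V :: "'a set" and E :: "'a set set"
    and w :: "real \<Rightarrow> 'a set \<Rightarrow> real"
    and e g :: "'a set" and u :: 'a
  assumes "tree V E" and "\<not> path_graph V E" and "\<not> star_graph V E"
    and "ricci_flow V E w"
    and "leaf_edge E e" and "leaf_edge E g" and "e \<noteq> g"
    and "u \<in> e" and "u \<in> g"
  shows "((w 0 e \<le> w 0 g \<longrightarrow> (\<forall>t>0. w t e \<le> w t g)) \<and>
          (w 0 e > w 0 g \<longrightarrow> (\<forall>t>0. w t e > w t g))) \<and>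
         ((\<lambda>t. w t e - w t g) \<longlongrightarrow> 0) at_top \<and>
         ((\<lambda>t. w t e / w t g) \<longlongrightarrow> 1) at_top"
proof -
  note T = assms(1) and R = assms(4)
  have G: "simple_graph V E" using T by (simp add: tree_def)
  have "\<exists>a. h = {u, a}" if "h \<in> E" "u \<in> h" for h
  proof -
    have "card h = 2" using G that by (simp add: simple_graph_def)
    then show ?thesis using that by (auto simp: card_2_iff)
  qed
  then obtain a b where ab: "e = {u, a}" "g = {u, b}"
    using assms(5-9) unfolding leaf_edge_def by metis
  have E: "{u, a} \<in> E" "{u, b} \<in> E" and "a \<noteq> b"
    using assms(5-7) ab by (auto simp: leaf_edge_def)
  have sub: "{a, b} \<subseteq> neighbors E u" using E by (auto simp: neighbors_def)
  have two: "2 \<le> degree E u"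
    using card_mono[OF finite_neighbors[OF G] sub] \<open>a \<noteq> b\<close> by (simp add: degree_def)
  \<comment> \<open>The endpoint of degree 1 cannot be \<open>u\<close>, whose degree is at least
    2.\<close>
  have leaf: "degree E a = 1" "degree E b = 1"
    using assms(5,6) ab two by (auto simp: leaf_edge_def)
  have three: "3 \<le> degree E u"
  proof (rule ccontr)
    assume "\<not> 3 \<le> degree E u"
    then have "card (neighbors E u) \<le> card {a, b}" using \<open>a \<noteq> b\<close> by (simp add: degree_def)
    then have "neighbors E u = {a, b}"
      using card_seteq[OF finite_neighbors[OF G] sub] by simp
    then show False
      using two_leaves_star[OF T] degree_1_neighbors leaf E assms(3) by metis
  qed
  have pos: "0 < w t h" if "0 \<le> t" "h \<in> E" for t h using R that by (simp add: ricci_flow_def)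
  note De = leaf_flow_equation[OF T R E(1) leaf(1), folded ab]
  note Dg = leaf_flow_equation[OF T R E(2) leaf(2), folded ab]
  define C where "C = w 0 e - w 0 g"
  have diff: "w t e - w t g = C * exp (- t)" if "0 \<le> t" for t
  proof -
    \<comment> \<open>Both terms have the same derivative, so the increment bound with constant 0,
      applied to the difference and to its negative, shows that it is constant.\<close>
    have "exp t * w t e - exp t * w t g = C"
    proof (rule antisym)
      show "C \<le> exp t * w t e - exp t * w t g"
        using half_line_increment_ge[OF DERIV_diff[OF De Dg], of 0 t] that by (simp add: C_def)
      show "exp t * w t e - exp t * w t g \<le> C"
        using half_line_increment_ge[OF DERIV_diff[OF Dg De], of 0 t] that by (simp add: C_def)
    qed
    then show ?thesis by (simp add: exp_minus field_simps)
  qed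
  \<comment> \<open>The growth rate of \<open>exp t * w t g\<close> at time 0. It bounds the rate at
    all later times, because the inverse weight sum at \<open>u\<close> grows at most by the factor
    \<open>exp t\<close>.\<close>
  let ?c = "(real (degree E u) - 2) / inv_weight_sum E (w 0) u"
  have D: "0 < inv_weight_sum E (w t) u" if "0 \<le> t" for t
    using inv_weight_sum_pos[OF G pos[OF that] E(1)] .
  have "0 < ?c" using D[of 0] three by simp
  have rate: "?c \<le> exp t * ((real (degree E u) - 2) / inv_weight_sum E (w t) u)" if "0 \<le> t" for t
  proof -
    have "?c = exp t * (real (degree E u) - 2) / (exp t * inv_weight_sum E (w 0) u)" by simp
    also have "\<dots> \<le> exp t * (real (degree E u) - 2) / inv_weight_sum E (w t) u"
      using flow_inv_weight_sum_le[OF T R two that] D[OF that] D[of 0] three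
      by (intro divide_left_mono) auto
    finally show ?thesis by simp
  qed
  have grow: "w 0 g + ?c * t \<le> exp t * w t g" if "0 \<le> t" for t
    using half_line_increment_ge[OF Dg rate that] by simp
  have "filterlim (\<lambda>t. w 0 g + ?c * t) at_top at_top"
    using \<open>0 < ?c\<close>
    by (intro filterlim_tendsto_add_at_top[OF tendsto_const]
        filterlim_tendsto_pos_mult_at_top[OF tendsto_const] filterlim_ident)
  then have "filterlim (\<lambda>t. exp t * w t g) at_top at_top"
    by (rule filterlim_at_top_mono) (rule eventually_mono[OF eventually_ge_at_top grow])
  then have "((\<lambda>t. 1 + C / (exp t * w t g)) \<longlongrightarrow> 1 + 0) at_top"
    by (intro tendsto_intros real_tendsto_divide_at_top[OF tendsto_const])
  moreover have "1 + C / (exp t * w t g) = w t e / w t g" if "0 \<le> t" for t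
  proof -
    have "0 < w t g" using pos that E ab by simp
    then have "w t e / w t g = 1 + (w t e - w t g) / w t g" by (simp add: field_simps)
    also have "\<dots> = 1 + C / (exp t * w t g)"
      unfolding diff[OF that] by (simp add: exp_minus field_simps)
    finally show ?thesis by simp
  qed
  \<comment> \<open>The identity is known for nonnegative times only, hence the passage to eventual
    equality.\<close>
  ultimately have ratio: "((\<lambda>t. w t e / w t g) \<longlongrightarrow> 1) at_top"
    by (auto elim!: Lim_transform_eventually intro: eventually_mono[OF eventually_ge_at_top[of 0]])
  have "((\<lambda>t. C * exp (- t)) \<longlongrightarrow> C * 0) at_top"
    by (intro tendsto_intros filterlim_compose[OF exp_at_bot] filterlim_uminus_at_bot_at_top)
  then have lim: "((\<lambda>t. w t e - w t g) \<longlongrightarrow> 0) at_top"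
    using diff by (auto elim!: Lim_transform_eventually
        intro: eventually_mono[OF eventually_ge_at_top[of 0]])
  have "w t e \<le> w t g" if "w 0 e \<le> w 0 g" "0 < t" for t
  proof -
    have "C * exp (- t) \<le> 0" using that by (simp add: C_def mult_le_0_iff)
    then show ?thesis using diff[of t] that by simp
  qed
  moreover have "w t g < w t e" if "w 0 g < w 0 e" "0 < t" for t
  proof -
    have "0 < C * exp (- t)" using that by (simp add: C_def)
    then show ?thesis using diff[of t] that by simp
  qed
  ultimately show ?thesis using ratio lim by blast
qed

end
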